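(* Let $D$ be a set, let $X$ be a real linear space and let $f\colon D\to X$ be an admissible function. Then both $\mathscr{B}_f$ and $\beta_f$ are delegative, and they are associated to each other.
   Context: Notation: $\mathbb{R}_+=(0,+\infty)$; $W_n=[0,+\infty)^n\setminus\{(0,\dots,0)\}$; $\mathscr{W}(D)=\bigcup_{n=1}^\infty D^n\times W_n$. For $(x,\lambda)\in D^n\times W_n$ and $(y,\mu)\in D^m\times W_m$, $((x,y),(\lambda,\mu))\in D^{n+m}\times W_{n+m}$ denotes the concatenation. Admissible functions and generalized Bajraktarević means: For a nonzero $x$ in a real linear space $X$, the ray generated by $x$ is $R_x=\{\lambda x\mid\lambda\in\mathbb{R}_+\}$; if $y\in R_x$, then $[y:x]$ denotes the unique positive number $\lambda$ with $y=\lambda x$. For $S\subseteq X$, $\operatorname{cone}(S)=\{\lambda x\mid \lambda\in\mathbb{R}_+,\ x\in S\}$. The set $S$ is observable if the rays generated by any two distinct elements of $S$ are disjoint, and conically convex if $\operatorname{cone}(S)$ is convex and $0\notin\operatorname{conv}(S)$. A function $f\colon D\to X$ is admissible if it is injective and $f(D)$ is observable and conically convex. For such $f$, $\pi_f\colon\operatorname{cone}(f(D))\to f(D)$ maps $y$ to the unique point $x\in f(D)$ with $y\in R_x$, and $f^{(-1)}:=f^{-1}\circ\pi_f\colon\operatorname{cone}(f(D))\to D$. For $(x,\lambda)\in D^n\times W_n$ put $\mathscr{B}_f(x,\lambda)=f^{(-1)}\big(\sum_{k=1}^n\lambda_kf(x_k)\big)$ and $\beta_f(x,\lambda)=\big[\sum_{k=1}^n\lambda_kf(x_k):f(\mathscr{B}_f(x,\lambda))\big]$.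 Delegativity: A function $\mathscr{M}\colon\mathscr{W}(D)\to D$ is delegative if for all $(y,\mu)\in\mathscr{W}(D)$ there exists $(y_0,\mu_0)\in D\times\mathbb{R}_+$ such that $\mathscr{M}((x,y),(\lambda,\mu))=\mathscr{M}((x,y_0),(\lambda,\mu_0))$ for all $(x,\lambda)\in\mathscr{W}(D)$. A function $\mathscr{E}\colon\mathscr{W}(D)\to\mathbb{R}_+$ is delegative if for all $(y,\mu)\in\mathscr{W}(D)$ there exists $(y_0,\mu_0)\in D\times\mathbb{R}_+$ such that $\mathscr{E}((x,y),(\lambda,\mu))=\mathscr{E}((x,y_0),(\lambda,\mu_0))$ for all $(x,\lambda)\in\mathscr{W}(D)$. Delegative $\mathscr{M}$ and $\mathscr{E}$ are associated if, for all $(y,\mu)\in\mathscr{W}(D)$, both of these equalities hold (for all $(x,\lambda)\in\mathscr{W}(D)$) with $(y_0,\mu_0)=(\mathscr{M}(y,\mu),\mathscr{E}(y,\mu))$. *)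

theory Defs
  imports "HOL-Analysis.Analysis"
begin

text \<open>Tuples are lists, so that concatenation of tuples is \<open>@\<close>.\<close>

definition weight_vectors :: "nat \<Rightarrow> real list set" where
  "weight_vectors n = {l. length l = n \<and> set l \<subseteq> {0..}} - {replicate n 0}"

definition weighted_tuples :: "'a set \<Rightarrow> ('a list \<times> real list) set" where
  "weighted_tuples D = (\<Union>n\<in>{1..}. {x. length x = n \<and> set x \<subseteq> D} \<times> weight_vectors n)"

text \<open>
  Rays and conical hulls use strictly positive scalars only; the library's \<^const>\<open>cone\<close>
  and the associated hull are different in that they allow the scalar 0.
  The ray of 0 is never relevant: admissibility below excludes 0 from the image.
\<close>

definition ray :: "'b::real_vector \<Rightarrow> 'b set" where
  "ray x = {c *\<^sub>R x | c. c > 0}"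

definition ray_ratio :: "'b::real_vector \<Rightarrow> 'b \<Rightarrow> real" where
  "ray_ratio y x = (THE c. c > 0 \<and> y = c *\<^sub>R x)"

definition pos_cone :: "'b::real_vector set \<Rightarrow> 'b set" where
  "pos_cone S = {c *\<^sub>R x | c x. c > 0 \<and> x \<in> S}"

definition observable :: "'b::real_vector set \<Rightarrow> bool" where
  "observable S \<longleftrightarrow> (\<forall>x\<in>S. \<forall>y\<in>S. x \<noteq> y \<longrightarrow> ray x \<inter> ray y = {})"

definition conically_convex :: "'b::real_vector set \<Rightarrow> bool" where
  "conically_convex S \<longleftrightarrow> convex (pos_cone S) \<and> 0 \<notin> convex hull S"

definition admissible :: "'a set \<Rightarrow> ('a \<Rightarrow> 'b::real_vector) \<Rightarrow> bool" where
  "admissible D f \<longleftrightarrow> inj_on f D \<and> observable (f ` D) \<and> conically_convex (f ` D)"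

text \<open>The next two functions are meaningful on \<^term>\<open>pos_cone (f ` D)\<close> only.\<close>

definition ray_proj :: "'a set \<Rightarrow> ('a \<Rightarrow> 'b::real_vector) \<Rightarrow> 'b \<Rightarrow> 'b" where
  "ray_proj D f y = (THE x. x \<in> f ` D \<and> y \<in> ray x)"

definition gen_inverse :: "'a set \<Rightarrow> ('a \<Rightarrow> 'b::real_vector) \<Rightarrow> 'b \<Rightarrow> 'a" where
  "gen_inverse D f = inv_into D f \<circ> ray_proj D f"

definition weighted_sum :: "('a \<Rightarrow> 'b::real_vector) \<Rightarrow> 'a list \<times> real list \<Rightarrow> 'b" where
  "weighted_sum f = (\<lambda>(x, l). \<Sum>k<length x. l ! k *\<^sub>R f (x ! k))"

definition baj_mean :: "'a set \<Rightarrow> ('a \<Rightarrow> 'b::real_vector) \<Rightarrow> 'a list \<times> real list \<Rightarrow> 'a" where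
  "baj_mean D f p = gen_inverse D f (weighted_sum f p)"

definition baj_weight :: "'a set \<Rightarrow> ('a \<Rightarrow> 'b::real_vector) \<Rightarrow> 'a list \<times> real list \<Rightarrow> real" where
  "baj_weight D f p = ray_ratio (weighted_sum f p) (f (baj_mean D f p))"

text \<open>
  Delegativity of a function from \<^term>\<open>weighted_tuples D\<close> to \<open>C\<close>, where \<open>C\<close> is \<open>D\<close> for
  mean-like functions and \<^term>\<open>{0<..} :: real set\<close> for weight-like functions. That the
  values lie in \<open>C\<close> is part of the notion.
\<close>

definition delegative :: "'a set \<Rightarrow> 'c set \<Rightarrow> ('a list \<times> real list \<Rightarrow> 'c) \<Rightarrow> bool" where
  "delegative D C M \<longleftrightarrow>
     M \<in> weighted_tuples D \<rightarrow> C \<and>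
     (\<forall>(y, m)\<in>weighted_tuples D. \<exists>y0\<in>D. \<exists>m0\<in>{0<..}.
        \<forall>(x, l)\<in>weighted_tuples D. M (x @ y, l @ m) = M (x @ [y0], l @ [m0]))"

definition associated ::
  "'a set \<Rightarrow> ('a list \<times> real list \<Rightarrow> 'a) \<Rightarrow> ('a list \<times> real list \<Rightarrow> real) \<Rightarrow> bool" where
  "associated D M E \<longleftrightarrow>
     delegative D D M \<and> delegative D {0<..} E \<and>
     (\<forall>(y, m)\<in>weighted_tuples D. \<forall>(x, l)\<in>weighted_tuples D.
        M (x @ y, l @ m) = M (x @ [M (y, m)], l @ [E (y, m)]) \<and>
        E (x @ y, l @ m) = E (x @ [M (y, m)], l @ [E (y, m)]))"

end

theory Submission
  imports Defs
begin

text \<open>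
  The mean and the weight of a tuple depend on the tuple only through its weighted sum, and
  together they are the polar coordinates of that sum. Indeed, a weighted sum lies in the cone
  over the image of \<open>f\<close>, because a convex cone is closed under addition
  (\<open>weighted_sum_in_pos_cone\<close>). By observability and injectivity, each vector of the cone is a
  positive multiple of \<open>f b\<close> for exactly one \<open>b\<close>, the mean; as 0 is not in the image, the
  multiple is unique too, and it is the weight (\<open>weighted_sum_polar\<close>). Hence the single entry formed by the mean of \<open>(y, m)\<close> with the
  weight of \<open>(y, m)\<close> has the same weighted sum as \<open>(y, m)\<close>. As weighted sums are additive under
  concatenation, the one may replace the other in any larger tuple without changing the
  weighted sum, and so without changing the mean or the weight. This is the association
  identity, and it exhibits the pair that delegativity asks for.
\<close>

lemma pos_cone_scaleR:
  assumes "v \<in> pos_cone S" "c > 0"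
  shows "c *\<^sub>R v \<in> pos_cone S"
proof -
  from assms(1) obtain d s where "v = d *\<^sub>R s" "d > 0" "s \<in> S"
    by (auto simp: pos_cone_def)
  then have "c *\<^sub>R v = (c * d) *\<^sub>R s" "c * d > 0"
    using assms(2) by auto
  with \<open>s \<in> S\<close> show ?thesis
    unfolding pos_cone_def by blast
qed

text \<open>The sum of two vectors is twice their midpoint.\<close>

lemma pos_cone_add:
  assumes "convex (pos_cone S)" "u \<in> pos_cone S" "v \<in> pos_cone S"
  shows "u + v \<in> pos_cone S"
proof -
  have "(1/2) *\<^sub>R u + (1/2) *\<^sub>R v \<in> pos_cone S"
    using assms by (intro convexD) auto
  then have "2 *\<^sub>R ((1/2) *\<^sub>R u + (1/2) *\<^sub>R v) \<in> pos_cone S"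
    by (rule pos_cone_scaleR) simp
  then show ?thesis
    by (simp add: scaleR_add_right)
qed

lemma weighted_sum_Cons:
  "weighted_sum f (a # x, c # l) = c *\<^sub>R f a + weighted_sum f (x, l)"
  by (simp add: weighted_sum_def sum.lessThan_Suc_shift del: sum.lessThan_Suc)

lemma weighted_sum_Nil: "weighted_sum f ([], l) = 0"
  by (simp add: weighted_sum_def)

lemma weighted_sum_append:
  assumes "length x = length l"
  shows "weighted_sum f (x @ y, l @ m) = weighted_sum f (x, l) + weighted_sum f (y, m)"
  using assms
  by (induction x l rule: list_induct2)
     (simp_all add: weighted_sum_Cons weighted_sum_Nil add.assoc)

text \<open>
  The cone need not contain 0, so entries of weight 0 cannot be absorbed by the closure
  properties of the cone. The induction therefore carries along that the sum vanishes
  when all weights do.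
\<close>

lemma weighted_sum_in_pos_cone_or_zero:
  assumes "length x = length l" "convex (pos_cone (f ` D))" "set x \<subseteq> D" "set l \<subseteq> {0..}"
  shows "if set l \<subseteq> {0} then weighted_sum f (x, l) = 0
         else weighted_sum f (x, l) \<in> pos_cone (f ` D)"
  using assms
proof (induction x l rule: list_induct2)
  case Nil
  show ?case by (simp add: weighted_sum_Nil)
next
  case (Cons a x c l)
  show ?case
  proof (cases "c = 0")
    case True
    with Cons show ?thesis by (simp add: weighted_sum_Cons)
  next
    case False
    with Cons.prems have "c > 0" "a \<in> D" by auto
    then have head: "c *\<^sub>R f a \<in> pos_cone (f ` D)"
      unfolding pos_cone_def by blast
    show ?thesis
      using False Cons head by (auto simp: weighted_sum_Cons intro: pos_cone_add split: if_splits)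
  qed
qed

lemma weighted_tuplesD:
  assumes "(x, l) \<in> weighted_tuples D"
  shows "length x = length l" "set x \<subseteq> D" "set l \<subseteq> {0..}" "\<not> set l \<subseteq> {0}"
proof -
  show "length x = length l" "set x \<subseteq> D" "set l \<subseteq> {0..}"
    using assms by (auto simp: weighted_tuples_def weight_vectors_def)
  have "l \<noteq> replicate (length l) 0"
    using assms by (auto simp: weighted_tuples_def weight_vectors_def)
  then show "\<not> set l \<subseteq> {0}"
    using replicate_eqI[of l "length l" 0] by blast
qed

lemma weighted_sum_in_pos_cone:
  assumes "admissible D f" "p \<in> weighted_tuples D"
  shows "weighted_sum f p \<in> pos_cone (f ` D)"
proof -
  obtain x l where p: "p = (x, l)" by fastforce
  note tuple = weighted_tuplesD[OF assms(2)[unfolded p]]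
  have "convex (pos_cone (f ` D))"
    using assms(1) by (simp add: admissible_def conically_convex_def)
  from weighted_sum_in_pos_cone_or_zero[OF tuple(1) this tuple(2,3)] tuple(4) show ?thesis
    unfolding p by simp
qed

text \<open>
  Observability makes the point of the image on the ray of \<open>c f(a)\<close> unique, and injectivity
  recovers \<open>a\<close> from it.
\<close>

lemma gen_inverse_scaleR:
  assumes "admissible D f" "a \<in> D" "c > 0"
  shows "gen_inverse D f (c *\<^sub>R f a) = a"
proof -
  have on_ray: "c *\<^sub>R f a \<in> ray (f a)"
    using assms(3) by (auto simp: ray_def)
  have "ray_proj D f (c *\<^sub>R f a) = f a"
    unfolding ray_proj_def
  proof (rule the_equality)
    fix s assume "s \<in> f ` D \<and> c *\<^sub>R f a \<in> ray s"
    with on_ray assms(1,2) show "s = f a"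
      unfolding admissible_def observable_def by blast
  qed (use assms(2) on_ray in auto)
  with assms(1,2) show ?thesis
    by (simp add: gen_inverse_def admissible_def inv_into_f_f)
qed

lemma ray_ratio_scaleR:
  assumes "v \<noteq> 0" "c > 0"
  shows "ray_ratio (c *\<^sub>R v) v = c"
  unfolding ray_ratio_def using assms by (intro the_equality) auto

lemma weighted_sum_polar:
  assumes "admissible D f" "p \<in> weighted_tuples D"
  shows "baj_mean D f p \<in> D" "baj_weight D f p > 0"
    and "weighted_sum f p = baj_weight D f p *\<^sub>R f (baj_mean D f p)"
proof -
  obtain c a where ca: "c > 0" "a \<in> D" "weighted_sum f p = c *\<^sub>R f a"
    using weighted_sum_in_pos_cone[OF assms] by (auto simp: pos_cone_def)
  then have mean: "baj_mean D f p = a"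
    using gen_inverse_scaleR[OF assms(1)] by (simp add: baj_mean_def)
  have "f a \<in> convex hull (f ` D)"
    using ca(2) by (simp add: hull_inc)
  then have "f a \<noteq> 0"
    using assms(1) by (auto simp: admissible_def conically_convex_def)
  then have "baj_weight D f p = c"
    using ca mean by (simp add: baj_weight_def ray_ratio_scaleR)
  with mean ca show "baj_mean D f p \<in> D" "baj_weight D f p > 0"
    "weighted_sum f p = baj_weight D f p *\<^sub>R f (baj_mean D f p)"
    by simp_all
qed

lemma weighted_sum_delegate:
  assumes "admissible D f" "(y, m) \<in> weighted_tuples D" "length x = length l"
  shows "weighted_sum f (x @ y, l @ m) =
         weighted_sum f (x @ [baj_mean D f (y, m)], l @ [baj_weight D f (y, m)])"
  using weighted_sum_polar(3)[OF assms(1,2)]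
  by (simp add: weighted_sum_append[OF assms(3)] weighted_sum_Cons weighted_sum_Nil)

lemma baj_delegate:
  assumes "admissible D f" "(y, m) \<in> weighted_tuples D" "length x = length l"
  shows "baj_mean D f (x @ y, l @ m) =
           baj_mean D f (x @ [baj_mean D f (y, m)], l @ [baj_weight D f (y, m)])"
    and "baj_weight D f (x @ y, l @ m) =
           baj_weight D f (x @ [baj_mean D f (y, m)], l @ [baj_weight D f (y, m)])"
  using weighted_sum_delegate[OF assms] by (simp_all add: baj_weight_def baj_mean_def)

text \<open>
  A replacement pair given by functions of \<open>(y, m)\<close> is in particular a witness for
  delegativity. Leaving \<open>C\<close> open lets one argument serve both the mean and the weight.
\<close>

lemma delegative_if_replacement:
  assumes "M \<in> weighted_tuples D \<rightarrow> C"
    and "\<And>y m. (y, m) \<in> weighted_tuples D \<Longrightarrow> b (y, m) \<in> D \<and> w (y, m) > 0"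
    and "\<And>x l y m. (x, l) \<in> weighted_tuples D \<Longrightarrow> (y, m) \<in> weighted_tuples D \<Longrightarrow>
           M (x @ y, l @ m) = M (x @ [b (y, m)], l @ [w (y, m)])"
  shows "delegative D C M"
  unfolding delegative_def
proof (intro conjI ballI, goal_cases)
  case 1
  show ?case by (fact assms(1))
next
  case (2 q)
  obtain y m where q: "q = (y, m)" by fastforce
  have "b (y, m) \<in> D" "w (y, m) \<in> {0<..}"
    using assms(2) 2 q by auto
  moreover have "\<forall>(x, l)\<in>weighted_tuples D. M (x @ y, l @ m) = M (x @ [b (y, m)], l @ [w (y, m)])"
    using assms(3) 2 q by blast
  ultimately show ?case
    unfolding q by blast
qed

theorem theorem4p1:
  fixes D :: "'a set" and f :: "'a \<Rightarrow> 'b::real_vector"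
  assumes "admissible D f"
  shows "delegative D D (baj_mean D f) \<and>
         delegative D {0<..} (baj_weight D f) \<and>
         associated D (baj_mean D f) (baj_weight D f)"
proof -
  note polar = weighted_sum_polar[OF assms]
  note replace = baj_delegate[OF assms _ weighted_tuplesD(1)]
  have mean: "delegative D D (baj_mean D f)"
    by (rule delegative_if_replacement[where b = "baj_mean D f" and w = "baj_weight D f"])
       (use polar replace in auto)
  have weight: "delegative D {0<..} (baj_weight D f)"
    by (rule delegative_if_replacement[where b = "baj_mean D f" and w = "baj_weight D f"])
       (use polar replace in auto)
  have "associated D (baj_mean D f) (baj_weight D f)"
    unfolding associated_def using mean weight replace by blast
  with mean weight show ?thesis by blast
qed

end
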